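(* Let $B=(X,Y;F)$ be a bipartite graph with parts $X$ and $Y$ and edge set $F$, and let $\ell:X\cup Y\to\mathbb{F}_2$ be a labelling such that $d_Y(x)\equiv\ell(x)\pmod 2$ for every $x\in X$. Then there are sets $X'\subseteq X$ and $Y'\subseteq Y$ with $|X'|+|Y'|\ge|X|$ such that $d_{Y'}(x)\equiv\ell(x)\pmod 2$ for every $x\in X'$ and $d_{X'}(y)\equiv\ell(y)\pmod 2$ for every $y\in Y'$.
   Context: All graphs are finite and simple. For a vertex $v$ of $B$ and a set $S\subseteq X\cup Y$, $d_S(v)=|N_B(v)\cap S|$ is the number of neighbours of $v$ in $B$ lying in $S$. *)

theory Defs
  imports Main "HOL-Library.Z2"
begin

definition bipartite_graph :: "'v set \<Rightarrow> 'v set \<Rightarrow> 'v set set \<Rightarrow> bool" where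
  "bipartite_graph X Y F \<longleftrightarrow>
     finite X \<and> finite Y \<and> X \<inter> Y = {} \<and> F \<subseteq> {{x, y} | x y. x \<in> X \<and> y \<in> Y}"

definition nbrs :: "'v set set \<Rightarrow> 'v \<Rightarrow> 'v set" where
  "nbrs F v = {w. {v, w} \<in> F}"

definition deg_in :: "'v set set \<Rightarrow> 'v set \<Rightarrow> 'v \<Rightarrow> nat" where
  "deg_in F S v = card (nbrs F v \<inter> S)"

text \<open>
  The two-element field is the type \<^typ>\<open>bit\<close>. A congruence modulo 2 between a natural
  number \<open>n\<close> and a label \<open>b\<close> is the equation \<open>of_nat n = b\<close> in that field.
\<close>

end

theory Submission
  imports Defs
begin

text \<open>
  Take a maximal \<open>U \<subseteq> Y\<close> to which every vertex of \<open>X\<close> sends an even number of edges, and let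
  \<open>Y' = Y - U\<close>. Passing from \<open>Y\<close> to \<open>Y'\<close> changes no degree parity on \<open>X\<close>, so any \<open>X' \<subseteq> X\<close> is
  admissible on that side. By maximality the columns of the biadjacency matrix over the
  two-element field that are indexed by \<open>Y'\<close> are linearly independent, so the conditions on \<open>Y'\<close>
  form a solvable linear system of rank \<open>card Y'\<close>. Its \<open>card X - card Y'\<close> free variables
  can all be set to 1.
\<close>

lemma of_nat_deg_in:
  assumes "finite S"
  shows "(of_nat (deg_in F S v) :: bit) = (\<Sum>w\<in>S. of_bool ({v, w} \<in> F))"
proof -
  have "nbrs F v \<inter> S = S \<inter> {w. {v, w} \<in> F}"
    by (auto simp: nbrs_def)
  then show ?thesis
    using assms by (simp add: deg_in_def sum_of_bool_eq)
qed

text \<open>Gaussian elimination: column \<open>y\<close> with pivot \<open>x\<close> is added to every other column that is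
  nonzero in row \<open>x\<close>. The value at \<open>x\<close> is left free until the end to satisfy equation \<open>y\<close>.\<close>

lemma heavy_solution_of_independent_columns:
  fixes M :: "'a \<Rightarrow> 'b \<Rightarrow> bit" and l :: "'b \<Rightarrow> bit"
  assumes "finite T" "finite X"
    and "\<And>W. W \<subseteq> T \<Longrightarrow> W \<noteq> {} \<Longrightarrow> \<exists>z\<in>X. (\<Sum>t\<in>W. M z t) \<noteq> 0"
  shows "\<exists>S\<subseteq>X. card X \<le> card S + card T \<and> (\<forall>t\<in>T. (\<Sum>z\<in>S. M z t) = l t)"
  using assms
proof (induction T arbitrary: X M l rule: finite_induct)
  case empty
  then show ?case by auto
next
  case (insert y T)
  obtain x where x: "x \<in> X" "M x y = 1"
    using insert.prems(2)[of "{y}"] by auto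
  define M' where "M' z t = M z t + M x t * M z y" for z t
  define l' where "l' t = l t + M x t * l y" for t
  have M'x: "M' x t = 0" for t
    by (simp add: M'_def x)
  have independent: "\<exists>z\<in>X - {x}. (\<Sum>t\<in>W. M' z t) \<noteq> 0" if W: "W \<subseteq> T" "W \<noteq> {}" for W
  proof -
    have "finite W" "y \<notin> W"
      using W insert.hyps finite_subset by auto
    define c where "c = (\<Sum>t\<in>W. M x t)"
    have M'_sum: "(\<Sum>t\<in>W. M' z t) = (\<Sum>t\<in>W. M z t) + c * M z y" for z
      by (simp only: M'_def c_def sum.distrib sum_distrib_right)
    \<comment> \<open>\<open>c\<close> is the parity of how often column \<open>y\<close> was added
      over \<open>W\<close>, so a dependency among the columns of \<open>M'\<close> lifts to one of
      \<open>M\<close>.\<close>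
    define W' where "W' = (if c = 0 then W else insert y W)"
    have "W' \<subseteq> insert y T" "W' \<noteq> {}"
      using W by (auto simp: W'_def)
    then obtain z where z: "z \<in> X" "(\<Sum>t\<in>W'. M z t) \<noteq> 0"
      using insert.prems(2) by blast
    moreover have "(\<Sum>t\<in>W'. M z t) = (\<Sum>t\<in>W. M' z t)"
      using \<open>finite W\<close> \<open>y \<notin> W\<close>
      by (cases c; cases "M z y") (simp_all add: W'_def M'_sum)
    \<comment> \<open>Row \<open>x\<close> of \<open>M'\<close> is zero, so the witness
      \<open>z\<close> differs from \<open>x\<close>.\<close>
    ultimately show ?thesis
      using M'x by (intro bexI[of _ z]) auto
  qed
  obtain S where S: "S \<subseteq> X - {x}" "card (X - {x}) \<le> card S + card T"
      "\<And>t. t \<in> T \<Longrightarrow> (\<Sum>z\<in>S. M' z t) = l' t"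
    using insert.IH[of "X - {x}" M' l'] insert.prems(1) independent by auto
  have fin: "finite S" "x \<notin> S"
    using S(1) insert.prems(1) finite_subset by auto
  \<comment> \<open>Adding \<open>x\<close> flips equation \<open>y\<close>, as
    \<open>M x y = 1\<close>, and keeps the reduced ones, as row \<open>x\<close> of
    \<open>M'\<close> is zero.\<close>
  define S' where "S' = (if (\<Sum>z\<in>S. M z y) = l y then S else insert x S)"
  have y: "(\<Sum>z\<in>S'. M z y) = l y"
    using fin x by (cases "\<Sum>z\<in>S. M z y"; cases "l y") (auto simp: S'_def)
  have "(\<Sum>z\<in>S'. M z t) = l t" if "t \<in> T" for t
  proof -
    have "(\<Sum>z\<in>S'. M z t) + M x t * l y = (\<Sum>z\<in>S'. M' z t)"
      by (simp only: M'_def sum.distrib sum_distrib_left y[symmetric])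
    also have "\<dots> = (\<Sum>z\<in>S. M' z t)"
      using fin M'x by (simp add: S'_def)
    also have "\<dots> = l t + M x t * l y"
      using S(3) that by (simp add: l'_def)
    finally show ?thesis by (simp only: add_right_cancel)
  qed
  moreover have "S' \<subseteq> X"
    using S(1) x by (auto simp: S'_def)
  \<comment> \<open>The column \<open>y\<close> pays for the pivot \<open>x\<close>, even if
    \<open>x\<close> is not in \<open>S'\<close>.\<close>
  moreover have "card X \<le> card S' + card (insert y T)"
    using S(2) insert x fin by (auto simp: S'_def)
  ultimately show ?case
    using y by (intro exI[of _ S']) auto
qed

theorem lemma3:
  fixes X Y :: "'v set" and F :: "'v set set" and l :: "'v \<Rightarrow> bit"
  assumes "bipartite_graph X Y F"
    and "\<forall>x\<in>X. of_nat (deg_in F Y x) = l x"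
  shows "\<exists>X' Y'. X' \<subseteq> X \<and> Y' \<subseteq> Y \<and> card X' + card Y' \<ge> card X \<and>
    (\<forall>x\<in>X'. of_nat (deg_in F Y' x) = l x) \<and>
    (\<forall>y\<in>Y'. of_nat (deg_in F X' y) = l y)"
proof -
  have fin: "finite X" "finite Y"
    using assms(1) by (auto simp: bipartite_graph_def)
  define M :: "'v \<Rightarrow> 'v \<Rightarrow> bit" where "M x y = of_bool ({x, y} \<in> F)" for x y
  define K where "K = {U. U \<subseteq> Y \<and> (\<forall>x\<in>X. (\<Sum>y\<in>U. M x y) = 0)}"
  have "finite K" "K \<noteq> {}"
    using fin by (auto simp: K_def intro!: exI[of _ "{}"])
  then obtain U where U: "U \<in> K" and U_max: "\<And>V. V \<in> K \<Longrightarrow> U \<subseteq> V \<Longrightarrow> U = V"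
    using finite_has_maximal[of K] by auto
  have "U \<subseteq> Y"
    using U by (simp add: K_def)
  have "\<exists>x\<in>X. (\<Sum>y\<in>W. M x y) \<noteq> 0" if W: "W \<subseteq> Y - U" "W \<noteq> {}" for W
  proof (rule ccontr)
    assume contr: "\<not> ?thesis"
    have "finite U" "finite W" "U \<inter> W = {}"
      using W \<open>U \<subseteq> Y\<close> fin by (auto intro: finite_subset)
    \<comment> \<open>Columns \<open>W\<close> with zero sum on \<open>X\<close> could be added to
      \<open>U\<close>, against maximality.\<close>
    then have "U \<union> W \<in> K"
      using contr U W by (auto simp: K_def sum.union_disjoint)
    then show False
      using U_max[of "U \<union> W"] W by blast
  qed
  then obtain S where S: "S \<subseteq> X" "card X \<le> card S + card (Y - U)"
      "\<And>y. y \<in> Y - U \<Longrightarrow> (\<Sum>x\<in>S. M x y) = l y"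
    using heavy_solution_of_independent_columns[of "Y - U" X M l] fin by auto
  have "of_nat (deg_in F (Y - U) x) = l x" if "x \<in> X" for x
  proof -
    have "(\<Sum>y\<in>Y. M x y) = (\<Sum>y\<in>Y - U. M x y) + (\<Sum>y\<in>U. M x y)"
      using \<open>U \<subseteq> Y\<close> fin(2) by (rule sum.subset_diff)
    then show ?thesis
      using assms(2) U fin that by (simp add: of_nat_deg_in K_def M_def)
  qed
  moreover have "of_nat (deg_in F S y) = l y" if "y \<in> Y - U" for y
    using S(3)[OF that] finite_subset[OF S(1)] fin
    by (simp add: of_nat_deg_in M_def insert_commute)
  ultimately show ?thesis
    using S by (intro exI[of _ S] exI[of _ "Y - U"]) auto
qed

end
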